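(* Let $\alpha\in\mathbb Z\setminus\{0,1\}$ and let $(h_n)$ be the sequence with $h_0=0$, $h_1=1$, $h_2=-\alpha^3(\alpha-1)(2\alpha-1)$, $h_3=-\alpha^8(\alpha-1)^3(2\alpha-1)^3$, $h_4=\alpha^{14}(\alpha-1)^6(2\alpha-1)^6$, and for $m\ge2$: $h_{2m+1}=h_{m+2}h_m^3-h_{m-1}h_{m+1}^3$, for $m\ge 3$: $h_{2m}=h_m\big(h_{m+2}h_{m-1}^2-h_{m-2}h_{m+1}^2\big)/h_2$. If $n\equiv 2,5,10,11,12,13,14,19,22\pmod{24}$, then $h_n$ is not a cube.
   Context: The sequence defined is the elliptic divisibility sequence attached to the point $(0,0)$ of order $8$ on the curve $y^2+(\alpha-\xi)xy-\alpha^3\xi y=x^3-\alpha^2\xi x^2$ with $\xi=(2\alpha-1)(\alpha-1)$. Convention: an integer $m$ is called a cube if $m=\beta^3$ for some nonzero integer $\beta$. *)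

theory Defs
  imports Complex_Main
begin

text \<open>Zero is deliberately not a cube.\<close>

definition is_cube :: "int \<Rightarrow> bool" where
  "is_cube m \<longleftrightarrow> (\<exists>\<beta>::int. \<beta> \<noteq> 0 \<and> m = \<beta> ^ 3)"

end

theory Submission
  imports Defs "HOL-Number_Theory.Cong" "HOL-Computational_Algebra.Nth_Powers"
    "HOL-Library.Discrete_Functions"
begin

text \<open>
  Because the point has order 8, \<open>h (8 k + r) = (-1) ^ k * w ^ (4 k\<^sup>2 + k r) * h r\<close> with
  \<open>w = - (\<alpha> ^ 15 * (\<alpha> - 1) ^ 7 * (2 \<alpha> - 1) ^ 6)\<close>. Up to cubes, \<open>h n\<close> for the listed residues is
  therefore \<open>(\<alpha> - 1) (2 \<alpha> - 1)\<close>, \<open>\<alpha>\<^sup>2 (\<alpha> - 1)\<close> or \<open>\<alpha>\<^sup>2 (\<alpha> - 1)\<^sup>2\<close>. The last two would give consecutive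
  nonzero cubes. The first would give \<open>v ^ 3 - 1 = 2 u ^ 3\<close>, which is excluded by Euler's theorem on
  \<open>x ^ 3 + y ^ 3 = 2 z ^ 3\<close>: writing \<open>x = p + q\<close>, \<open>y = p - q\<close>, the equation becomes
  \<open>p (p\<^sup>2 + 3 q\<^sup>2) = z ^ 3\<close>, and the parametrization of the cubes of the form \<open>p\<^sup>2 + 3 q\<^sup>2\<close> yields a
  solution with smaller \<open>z\<close>. The parametrization comes from Thue's lemma instead of unique
  factorization in \<open>\<int>[\<omega>]\<close>.
\<close>

section \<open>Cubes of the form \<open>p\<^sup>2 + 3 q\<^sup>2\<close>\<close>

text \<open>Pigeonhole: with \<open>t\<close> the integer square root of \<open>s\<close>, the box
  \<open>{0..t} \<times> {0..t}\<close> has more than \<open>s\<close> points, so two of them give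
  the same \<open>x - c * y\<close> modulo \<open>s\<close>. Their difference is the required
  pair.\<close>

lemma thue:
  fixes c s :: int
  assumes "s > 0"
  obtains u v :: int where "u \<noteq> 0 \<or> v \<noteq> 0" "u\<^sup>2 \<le> s" "v\<^sup>2 \<le> s" "s dvd u - c * v"
proof -
  define t where "t = int (floor_sqrt (nat s))"
  have t0: "t \<ge> 0" by (simp add: t_def)
  have "int ((floor_sqrt (nat s))\<^sup>2) \<le> int (nat s)"
    by (subst of_nat_le_iff) simp
  then have t1: "t\<^sup>2 \<le> s" using assms by (simp add: t_def)
  have "int (nat s) < int ((Suc (floor_sqrt (nat s)))\<^sup>2)"
    by (subst of_nat_less_iff) (rule Suc_floor_sqrt_power2_gt)
  then have t2: "s < (t + 1)\<^sup>2" using assms by (simp add: t_def add.commute)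
  define S where "S = {0..t} \<times> {0..t}"
  define f where "f = (\<lambda>(x, y). (x - c * y) mod s)"
  have "f ` S \<subseteq> {0..<s}" using assms by (auto simp: f_def)
  then have "card (f ` S) \<le> nat s" using card_mono[of "{0..<s}" "f ` S"] by simp
  also have "nat s < nat ((t + 1)\<^sup>2)" using t2 assms by linarith
  also have "\<dots> = card S"
    using t0 by (simp add: S_def card_cartesian_product power2_eq_square nat_mult_distrib)
  finally obtain x y x' y' where *: "(x, y) \<in> S" "(x', y') \<in> S" "(x, y) \<noteq> (x', y')"
      "f (x, y) = f (x', y')"
    using pigeonhole[of f S] unfolding inj_on_def by force
  have sq: "z\<^sup>2 \<le> s" if "\<bar>z\<bar> \<le> t" for z
  proof -
    have "\<bar>z\<bar>\<^sup>2 \<le> t\<^sup>2" using that by (intro power_mono) auto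
    with t1 show ?thesis by simp
  qed
  show ?thesis
  proof (rule that[of "x - x'" "y - y'"])
    show "x - x' \<noteq> 0 \<or> y - y' \<noteq> 0" using *(3) by auto
    show "(x - x')\<^sup>2 \<le> s" "(y - y')\<^sup>2 \<le> s" using *(1,2) by (auto simp: S_def intro!: sq)
    have "s dvd (x - c * y) - (x' - c * y')"
      using *(4) by (simp add: f_def mod_eq_dvd_iff)
    then show "s dvd x - x' - c * (y - y')" by (simp add: algebra_simps)
  qed
qed

text \<open>The pair from Thue's lemma satisfies u^2 + 3 v^2 = v^2 (c^2 + 3) = 0 modulo
  \<open>s\<close>, and its norm is positive and at most \<open>4 * s\<close>. So the norm is
  \<open>s * k\<close> with \<open>k\<close> from 1 to 4, and each \<open>k > 1\<close> is either
  impossible or reducible to a representation of \<open>s\<close> itself.\<close>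

lemma represented_by_norm_form:
  fixes c s :: int
  assumes "s > 0" "odd s" "\<not> 3 dvd s" "s dvd c\<^sup>2 + 3"
  obtains u v :: int where "u\<^sup>2 + 3 * v\<^sup>2 = s" "s dvd u - c * v"
proof -
  obtain u v :: int where uv: "u \<noteq> 0 \<or> v \<noteq> 0" "u\<^sup>2 \<le> s" "v\<^sup>2 \<le> s" "s dvd u - c * v"
    using thue[OF assms(1)] by blast
  have "s dvd (u - c * v) * (u + c * v) + v\<^sup>2 * (c\<^sup>2 + 3)"
    by (rule dvd_add[OF dvd_mult2[OF uv(4)] dvd_mult[OF assms(4)]])
  also have "\<dots> = u\<^sup>2 + 3 * v\<^sup>2" by algebra
  finally obtain k where k: "u\<^sup>2 + 3 * v\<^sup>2 = s * k" by blast
  have "u\<^sup>2 + 3 * v\<^sup>2 > 0" using uv(1)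
    by (metis add_nonneg_pos add_pos_nonneg mult_pos_pos zero_le_mult_iff zero_le_numeral zero_le_power2 zero_less_numeral zero_less_power2)
  then have "k > 0" using k assms(1) by (simp add: zero_less_mult_iff)
  moreover have "s * k \<le> s * 4" using k uv(2,3) by linarith
  then have "k \<le> 4" using assms(1) by simp
  ultimately consider "k = 1" | "k = 2" | "k = 3" | "k = 4" by linarith
  then show ?thesis
  proof cases
    case 1
    with k uv(4) that show ?thesis by simp
  next
    case 2
    then have "u\<^sup>2 + 3 * v\<^sup>2 = 2 * s" using k by simp
    moreover obtain s' where "s = 2 * s' + 1" using assms(2) by (elim oddE)
    \<comment> \<open>The factors \<open>u + v\<close> and \<open>u - v\<close> have equal parity,
      so their product cannot be twice an odd number.\<close>
    ultimately have *: "(u + v) * (u - v) = 2 * (2 * (s' - v\<^sup>2) + 1)" by algebra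
    then have "even ((u + v) * (u - v))" by simp
    then have "even (u + v)" "even (u - v)" by auto
    then have "2 * 2 dvd (u + v) * (u - v)" by (rule mult_dvd_mono)
    then have "even (2 * (s' - v\<^sup>2) + 1)" unfolding * by (simp only: dvd_mult_cancel_left) simp
    then show ?thesis by simp
  next
    case 3
    then have k3: "u\<^sup>2 + 3 * v\<^sup>2 = 3 * s" using k by simp
    then have "3 dvd u\<^sup>2" by presburger
    then have "3 dvd u" by (simp add: prime_dvd_power_iff)
    then obtain u' where u': "u = 3 * u'" by blast
    \<comment> \<open>Dividing u + v sqrt(-3) by sqrt(-3) gives v - u' sqrt(-3), of norm
      \<open>s\<close>; this pair still satisfies the congruence with \<open>c\<close>.\<close>
    have "s dvd v * (c\<^sup>2 + 3) + c * (u - c * v)"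
      by (rule dvd_add[OF dvd_mult[OF assms(4)] dvd_mult[OF uv(4)]])
    also have "\<dots> = 3 * (v - c * (- u'))" unfolding u' by algebra
    finally have "s dvd 3 * (v - c * (- u'))" .
    moreover have "coprime s 3"
      using assms(3) prime_imp_coprime[of 3 s] by (simp add: coprime_commute)
    ultimately have "s dvd v - c * (- u')" using coprime_dvd_mult_right_iff by blast
    moreover have "v\<^sup>2 + 3 * (- u')\<^sup>2 = s" using k3 unfolding u' by algebra
    ultimately show ?thesis using that by blast
  next
    case 4
    then have "u\<^sup>2 + 3 * v\<^sup>2 = 4 * s" using k by simp
    \<comment> \<open>Both bounds are attained. Then \<open>c\<close> is 1 or -1 modulo
      \<open>v\<close>, so \<open>v\<close> divides (c^2 + 3) - (c^2 - 1) = 4; being odd, it is a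
      unit, and \<open>s = 1\<close>.\<close>
    then have sq: "u\<^sup>2 = s" "v\<^sup>2 = s" using uv(2,3) by linarith+
    then have "v \<noteq> 0" using assms(1) by auto
    have "v dvd c\<^sup>2 - 1"
    proof -
      have "u = v \<or> u = - v" using sq power2_eq_iff by metis
      then have "u = v * 1 \<or> u = v * (- 1)" by simp
      moreover have "1\<^sup>2 = (1::int)" "(- 1)\<^sup>2 = (1::int)" by simp_all
      ultimately obtain e :: int where e: "u = v * e" "e\<^sup>2 = 1" by blast
      have "v * v dvd v * (e - c)"
        using uv(4) e sq by (simp add: power2_eq_square algebra_simps)
      then have "v dvd e - c" using \<open>v \<noteq> 0\<close> by simp
      then have "v dvd (e - c) * (- e - c)" by simp
      also have "\<dots> = c\<^sup>2 - 1" using e(2) by algebra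
      finally show ?thesis .
    qed
    moreover have "v dvd c\<^sup>2 + 3"
      using assms(4) sq(2) by (metis dvd_trans dvd_triv_left power2_eq_square)
    ultimately have "v dvd (c\<^sup>2 + 3) - (c\<^sup>2 - 1)" by (rule dvd_diff[rotated])
    then have "v dvd 2 * 2" by simp
    moreover have "odd v" using sq(2) assms(2) by auto
    then have "coprime v 2" by simp
    ultimately have "v dvd 2" using coprime_dvd_mult_right_iff by blast
    with \<open>coprime v 2\<close> have "is_unit v" by (rule coprime_common_divisor[OF _ dvd_refl])
    then have "\<bar>v\<bar> = 1" by simp
    then have "s = 1" using sq(2) by (metis one_power2 power2_abs)
    then show ?thesis using that[of 1 0] by simp
  qed
qed

text \<open>Take \<open>c\<close> to be p/q modulo \<open>s ^ 3\<close>, a square root of -3 there,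
  and represent \<open>s\<close> by \<open>u\<close>, \<open>v\<close> compatibly with
  \<open>c\<close>. Then p + q sqrt(-3) and (u + v sqrt(-3))^3 have the same norm and lie over the
  same root \<open>c\<close>, which forces them to agree up to sign.\<close>

lemma cube_norm_form:
  fixes p q s :: int
  assumes "coprime p q" "odd s" "p\<^sup>2 + 3 * q\<^sup>2 = s ^ 3"
  obtains u v :: int where "p = u * (u\<^sup>2 - 9 * v\<^sup>2)" "q = 3 * v * (u\<^sup>2 - v\<^sup>2)"
proof -
  have "s ^ 3 \<ge> 0" using assms(3) by (metis add_nonneg_nonneg zero_le_mult_iff zero_le_numeral zero_le_power2)
  then have "s \<ge> 0" by (simp add: zero_le_power_eq)
  with assms(2) have s: "s > 0" by presburger
  have cop: "coprime q s"
  proof (rule coprimeI)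
    fix l :: int assume l: "l dvd q" "l dvd s"
    then have "l dvd s ^ 3 - 3 * q\<^sup>2" by (simp add: power2_eq_square power3_eq_cube)
    then have "l dvd p\<^sup>2" using assms(3) by (metis add_diff_cancel_right')
    moreover have "coprime (p\<^sup>2) q" using assms(1) by simp
    ultimately show "is_unit l" using l(1) coprime_common_divisor by blast
  qed
  have s3: "\<not> 3 dvd s"
  proof
    assume "3 dvd s"
    then obtain s' where s': "s = 3 * s'" by blast
    then have *: "p\<^sup>2 + 3 * q\<^sup>2 = 27 * s' ^ 3" using assms(3) by (simp add: power_mult_distrib)
    then have "3 dvd p\<^sup>2" by presburger
    then have "3 dvd p" by (simp add: prime_dvd_power_iff)
    then obtain p' where "p = 3 * p'" by blast
    with * have "q\<^sup>2 = 3 * (3 * s' ^ 3 - p'\<^sup>2)" by (simp add: power_mult_distrib)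
    then have "3 dvd q\<^sup>2" by simp
    then have "3 dvd q" by (simp add: prime_dvd_power_iff)
    with \<open>3 dvd s\<close> cop show False using coprime_common_divisor by fastforce
  qed
  have "coprime q (s ^ 3)" using cop by simp
  then obtain i where i: "s ^ 3 dvd q * i - 1"
    using cong_solve_coprime_int[of q "s ^ 3"] by (auto simp: cong_iff_dvd_diff)
  define c where "c = p * i"
  have pc: "s ^ 3 dvd p - c * q"
  proof -
    have "s ^ 3 dvd - p * (q * i - 1)" using i by (rule dvd_mult)
    then show ?thesis by (simp add: c_def algebra_simps)
  qed
  have c3: "s ^ 3 dvd c\<^sup>2 + 3"
  proof -
    have "s ^ 3 dvd i\<^sup>2 * (p\<^sup>2 + 3 * q\<^sup>2) - 3 * (q * i + 1) * (q * i - 1)"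
      unfolding assms(3) by (rule dvd_diff[OF dvd_triv_right dvd_mult[OF i]])
    also have "\<dots> = c\<^sup>2 + 3" unfolding c_def by algebra
    finally show ?thesis .
  qed
  then have "s dvd c\<^sup>2 + 3" by (rule dvd_trans[rotated]) simp
  then obtain u v where uv: "u\<^sup>2 + 3 * v\<^sup>2 = s" "s dvd u - c * v"
    using represented_by_norm_form[OF s assms(2) s3] by blast
  define P where "P = u * (u\<^sup>2 - 9 * v\<^sup>2)"
  define Q where "Q = 3 * v * (u\<^sup>2 - v\<^sup>2)"
  have PQ: "P\<^sup>2 + 3 * Q\<^sup>2 = s ^ 3" unfolding P_def Q_def uv(1)[symmetric] by algebra
  \<comment> \<open>Modulo \<open>s ^ 3\<close>, sending \<open>\<surd>(-3)\<close> to \<open>- c\<close> is a ring homomorphism killing \<open>(u + v \<surd>(-3)) ^ 3 = P + Q \<surd>(-3)\<close>.\<close>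
  have PcQ: "s ^ 3 dvd P - c * Q"
  proof -
    have "s ^ 3 dvd (u - c * v) ^ 3 + (c\<^sup>2 + 3) * (c * v ^ 3 - 3 * u * v\<^sup>2)"
      using uv(2) by (intro dvd_add dvd_mult2[OF c3] dvd_power_same)
    also have "\<dots> = P - c * Q" unfolding P_def Q_def by algebra
    finally show ?thesis .
  qed
  \<comment> \<open>\<open>p * P + 3 * q * Q\<close> and \<open>q * P - p * Q\<close> are the
    coordinates of (p + q sqrt(-3)) (P - Q sqrt(-3)). Both are divisible by \<open>s ^ 3\<close>,
    and the quotient x + y sqrt(-3) has norm 1, so it is 1 or -1.\<close>
  have "s ^ 3 dvd (p - c * q) * P + c * q * (P - c * Q) + (c\<^sup>2 + 3) * (q * Q)"
    by (intro dvd_add dvd_mult2[OF pc] dvd_mult[OF PcQ] dvd_mult2[OF c3])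
  also have "\<dots> = p * P + 3 * q * Q" by algebra
  finally obtain x where x: "p * P + 3 * q * Q = s ^ 3 * x" by blast
  have "s ^ 3 dvd q * (P - c * Q) - Q * (p - c * q)"
    by (intro dvd_diff dvd_mult[OF pc] dvd_mult[OF PcQ])
  also have "\<dots> = q * P - p * Q" by algebra
  finally obtain y where y: "q * P - p * Q = s ^ 3 * y" by blast
  have "(s ^ 3)\<^sup>2 * (x\<^sup>2 + 3 * y\<^sup>2) = (p * P + 3 * q * Q)\<^sup>2 + 3 * (q * P - p * Q)\<^sup>2"
    unfolding x y by algebra
  also have "\<dots> = (p\<^sup>2 + 3 * q\<^sup>2) * (P\<^sup>2 + 3 * Q\<^sup>2)" by algebra
  also have "\<dots> = (s ^ 3)\<^sup>2 * 1" unfolding PQ assms(3) by algebra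
  finally have xy: "x\<^sup>2 + 3 * y\<^sup>2 = 1" using s by simp
  have "y = 0"
  proof (rule ccontr)
    assume "y \<noteq> 0"
    then have "y\<^sup>2 > 0" by simp
    then show False using xy zero_le_power2[of x] by linarith
  qed
  with xy have "x\<^sup>2 = 1" by simp
  have "s ^ 3 * p = s ^ 3 * (x * P)" 
  proof -
    have "p * (P\<^sup>2 + 3 * Q\<^sup>2) = (p * P + 3 * q * Q) * P - 3 * Q * (q * P - p * Q)" by algebra
    then show ?thesis unfolding x y PQ \<open>y = 0\<close> by (simp add: mult_ac)
  qed
  then have p: "p = x * P" using s by simp
  have "s ^ 3 * q = s ^ 3 * (x * Q)" 
  proof -
    have "q * (P\<^sup>2 + 3 * Q\<^sup>2) = (p * P + 3 * q * Q) * Q + P * (q * P - p * Q)" by algebra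
    then show ?thesis unfolding x y PQ \<open>y = 0\<close> by (simp add: mult_ac)
  qed
  then have q: "q = x * Q" using s by simp
  \<comment> \<open>\<open>P\<close> and \<open>Q\<close> are homogeneous of odd degree in
    \<open>u\<close>, \<open>v\<close>, so the sign \<open>x\<close> can be moved inside.\<close>
  show ?thesis
    by (rule that[of "x * u" "x * v"])
       (use p q \<open>x\<^sup>2 = 1\<close> in \<open>unfold P_def Q_def, algebra, algebra\<close>)
qed

text \<open>Unique factorization gives this for absolute values; the sign is harmless because -1 is
  a cube.\<close>

lemma coprime_mult_eq_cube:
  fixes a b c :: int
  assumes "coprime a b" "a * b = c ^ 3"
  obtains r where "a = r ^ 3"
proof -
  have "is_nth_power 3 (nat \<bar>a\<bar> * nat \<bar>b\<bar>)"
    using assms(2) by (metis abs_ge_zero abs_mult is_nth_powerI nat_mult_distrib nat_power_eq power_abs)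
  moreover have "coprime (nat \<bar>a\<bar>) (nat \<bar>b\<bar>)" using assms(1) by simp
  ultimately have "is_nth_power 3 (nat \<bar>a\<bar>)" by (simp add: is_nth_power_mult_coprime_nat_iff)
  then obtain r where "nat \<bar>a\<bar> = r ^ 3" by (auto simp: is_nth_power_def)
  then have "\<bar>a\<bar> = int r ^ 3" by (metis abs_ge_zero nat_0_le of_nat_power)
  then have "a = int r ^ 3 \<or> a = (- int r) ^ 3" by (auto simp: abs_if split: if_splits)
  then show ?thesis using that by blast
qed


section \<open>Euler's theorem on \<open>x ^ 3 + y ^ 3 = 2 z ^ 3\<close>\<close>

lemma coprime_mult3_eq_cube:
  fixes a b c d :: int
  assumes "coprime a b" "coprime a c" "coprime b c" "a * b * c = d ^ 3"
  obtains x y z where "a = x ^ 3" "b = y ^ 3" "c = z ^ 3"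
proof -
  have "coprime a (b * c)" "coprime b (a * c)" "coprime c (a * b)"
    using assms(1-3) by (simp_all add: coprime_commute)
  moreover have "a * (b * c) = d ^ 3" "b * (a * c) = d ^ 3" "c * (a * b) = d ^ 3"
    using assms(4) by (simp_all add: mult_ac)
  ultimately show ?thesis
    using that coprime_mult_eq_cube by metis
qed

lemma coprime_add_diff:
  fixes u v :: int
  assumes "coprime u v" "odd (u + v)"
  shows "coprime (u + v) (u - v)"
proof (rule coprimeI)
  fix l assume l: "l dvd u + v" "l dvd u - v"
  then have "l dvd (u + v) + (u - v)" "l dvd (u + v) - (u - v)"
    by (blast intro: dvd_add dvd_diff)+
  then have "l dvd 2 * u" "l dvd 2 * v" by simp_all
  moreover have "odd l" using l(1) assms(2) dvd_trans by blast
  then have "coprime l 2" by simp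
  ultimately have "l dvd u" "l dvd v" using coprime_dvd_mult_right_iff by blast+
  with assms(1) show "is_unit l" using coprime_common_divisor by blast
qed

lemma coprime_self_add_diff:
  fixes u v :: int
  assumes "coprime u v"
  shows "coprime u (u + v)" "coprime u (u - v)" "coprime u (v - u)"
proof -
  have "is_unit l" if "l dvd u" "l dvd v" for l using assms that coprime_common_divisor by blast
  then show "coprime u (u + v)" "coprime u (u - v)" "coprime u (v - u)"
    by (auto intro!: coprimeI simp: dvd_add_right_iff dvd_diff_right_iff dvd_diff_left_iff)
qed

text \<open>Supplies the decrease in the descent: \<open>d\<close> will be \<open>p\<close>,
  \<open>e\<close> the factor p^2 + 3 q^2, and \<open>c\<close> the new value of
  \<open>z\<close>.\<close>

lemma abs_less_of_cube_dvd:
  fixes c d z :: int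
  assumes "c ^ 3 dvd d" "d * e = z ^ 3" "d \<noteq> 0" "e > 1"
  shows "\<bar>c\<bar> < \<bar>z\<bar>"
proof -
  have "\<bar>c\<bar> ^ 3 \<le> \<bar>d\<bar>" using dvd_imp_le_int[OF assms(3,1)] by (simp add: power_abs)
  also have "\<bar>d\<bar> * 1 < \<bar>d\<bar> * e" using assms(3,4) by (intro mult_strict_left_mono) auto
  then have "\<bar>d\<bar> < \<bar>z\<bar> ^ 3" using assms(2,4) by (simp add: power_abs[symmetric] abs_mult flip: assms(2))
  finally show ?thesis by (rule power_less_imp_less_base) simp
qed

text \<open>The sum \<open>p + q\<close> has the parity of p^2 + 3 q^2, so \<open>s\<close> is odd.
  A common divisor of \<open>u\<close> and \<open>v\<close> divides both \<open>p\<close> and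
  \<open>q\<close>, and \<open>p + q\<close> would be even if \<open>u + v\<close> were.\<close>

lemma norm_form_cube_parametrization:
  fixes p q s :: int
  assumes "coprime p q" "odd (p + q)" "p\<^sup>2 + 3 * q\<^sup>2 = s ^ 3"
  obtains u v :: int where "p = u * (u\<^sup>2 - 9 * v\<^sup>2)" "q = 3 * v * (u\<^sup>2 - v\<^sup>2)"
    "coprime u v" "odd (u + v)"
proof -
  have "odd (s ^ 3)" using assms(2) unfolding assms(3)[symmetric] by auto
  then have "odd s" by simp
  then obtain u v where uv: "p = u * (u\<^sup>2 - 9 * v\<^sup>2)" "q = 3 * v * (u\<^sup>2 - v\<^sup>2)"
    using cube_norm_form[OF assms(1) _ assms(3)] by blast
  have "coprime u v"
  proof (rule coprimeI)
    fix l assume "l dvd u" "l dvd v"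
    then have "l dvd p" "l dvd q" unfolding uv by auto
    with assms(1) show "is_unit l" using coprime_common_divisor by blast
  qed
  moreover have "odd (u + v)" using assms(2) unfolding uv by auto
  ultimately show ?thesis using uv that by blast
qed

text \<open>Descent on the absolute value of \<open>z\<close>. Since \<open>p\<close> and
  \<open>q\<close> are coprime, \<open>p\<close> and p^2 + 3 q^2 can share only the prime 3, hence
  the split on \<open>3 dvd p\<close>. Either way the parametrization writes a cube as a product of
  three coprime factors, and the cubes so obtained form a smaller solution. By induction that
  solution is trivial, which makes \<open>q = 0\<close>.\<close>

theorem sum_of_two_cubes_eq_twice_cube:
  fixes x y z :: int
  assumes "coprime x y" "x ^ 3 + y ^ 3 = 2 * z ^ 3" "z \<noteq> 0"
  shows "x = y"
  using assms
proof (induction "nat \<bar>z\<bar>" arbitrary: x y z rule: less_induct)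
  case less
  note IH = less.hyps and cop = less.prems(1) and eq = less.prems(2) and z0 = less.prems(3)
  have "even (x ^ 3 + y ^ 3)" unfolding eq by simp
  moreover have "\<not> (even x \<and> even y)" using cop coprime_common_divisor[of x y 2] by auto
  ultimately have odd: "odd x" "odd y" by auto
  then obtain p q where pq: "x + y = 2 * p" "x - y = 2 * q" by (metis dvdE odd_add even_diff)
  then have x: "x = p + q" and y: "y = p - q" by auto
  have cpq: "coprime p q"
  proof (rule coprimeI)
    fix l assume "l dvd p" "l dvd q"
    then have "l dvd x" "l dvd y" unfolding x y by auto
    with cop show "is_unit l" using coprime_common_divisor by blast
  qed
  have opq: "odd (p + q)" using odd x by simp
  have "2 * (p * (p\<^sup>2 + 3 * q\<^sup>2)) = 2 * z ^ 3" using eq unfolding x y by algebra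
  then have pz: "p * (p\<^sup>2 + 3 * q\<^sup>2) = z ^ 3" by simp
  have p0: "p \<noteq> 0" using pz z0 by auto
  have "q = 0"
  proof (rule ccontr)
    assume q0: "q \<noteq> 0"
    have sq: "p\<^sup>2 > 0" "q\<^sup>2 > 0" using p0 q0 by simp_all
    then have norm: "p\<^sup>2 + 3 * q\<^sup>2 > 1" by linarith
    show False
    proof (cases "3 dvd p")
      case False
      then have p3: "coprime p 3" using prime_imp_coprime[of 3 p] by (simp add: coprime_commute)
      have "coprime p (3 * q\<^sup>2)" using p3 cpq by simp
      then have "coprime p (p * p + 3 * q\<^sup>2)"
        by (metis coprime_iff_gcd_eq_1 gcd_add_mult)
      then have c: "coprime p (p\<^sup>2 + 3 * q\<^sup>2)" by (simp add: power2_eq_square)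
      obtain r where r: "p = r ^ 3" using coprime_mult_eq_cube[OF c pz] by blast
      obtain s where s: "p\<^sup>2 + 3 * q\<^sup>2 = s ^ 3"
        using coprime_mult_eq_cube[of "p\<^sup>2 + 3 * q\<^sup>2" p z] c pz by (metis coprime_commute mult.commute)
      obtain u v where uv: "p = u * (u\<^sup>2 - 9 * v\<^sup>2)" "q = 3 * v * (u\<^sup>2 - v\<^sup>2)"
        "coprime u v" "odd (u + v)"
        using norm_form_cube_parametrization[OF cpq opq s] by blast
      have "coprime u 3" using p3 uv(1) by simp
      then have u3v: "coprime u (3 * v)" using uv(3) by simp
      have "odd (u + 3 * v)" using uv(4) by simp
      note 1 = coprime_add_diff[OF u3v this] coprime_self_add_diff[OF u3v]
      \<comment> \<open>All three factors become cubes, and the last two add up to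
        \<open>2 * u\<close>.\<close>
      have "u * (u + 3 * v) * (u - 3 * v) = r ^ 3"
        using uv(1) unfolding r by (simp add: power2_eq_square algebra_simps)
      with 1 obtain c a b where abc: "u = c ^ 3" "u + 3 * v = a ^ 3" "u - 3 * v = b ^ 3"
        using coprime_mult3_eq_cube by metis
      have "coprime (a ^ 3) (b ^ 3)" using 1(1) unfolding abc(2,3) .
      then have "coprime a b" by simp
      moreover have "a ^ 3 + b ^ 3 = 2 * c ^ 3" unfolding abc[symmetric] by simp
      moreover have "c \<noteq> 0" using abc(1) uv(1) p0 by auto
      moreover have "c ^ 3 dvd p" using uv(1) abc(1) by simp
      then have "\<bar>c\<bar> < \<bar>z\<bar>" using abs_less_of_cube_dvd[OF _ pz p0] norm by blast
      then have "nat \<bar>c\<bar> < nat \<bar>z\<bar>" by linarith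
      ultimately have "a = b" using IH by blast
      then have "v = 0" using abc by simp
      then show False using uv(2) q0 by simp
    next
      case True
      then obtain t' where t': "p = 3 * t'" by blast
      have "z ^ 3 = 3 * (3 * (t' * (q\<^sup>2 + 3 * t'\<^sup>2)))" using pz unfolding t' by algebra
      then have "3 dvd z ^ 3" by simp
      then have "3 dvd z" by (simp add: prime_dvd_power_iff)
      then obtain z' where z': "z = 3 * z'" by blast
      \<comment> \<open>As 3 does not divide \<open>q\<close>, the 3 on the right must come from
        \<open>t'\<close>. Hence \<open>p = 9 * t\<close>, and the norm form reappears with
        \<open>q\<close> and \<open>3 * t\<close> in the places of \<open>p\<close> and
        \<open>q\<close>.\<close>
      have e: "t' * (q\<^sup>2 + 3 * t'\<^sup>2) = 3 * z' ^ 3"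
        using pz unfolding t' z' by (simp add: power_mult_distrib algebra_simps)
      have q3: "\<not> 3 dvd q" using True cpq coprime_common_divisor[of p q 3] by auto
      have "3 dvd t' * (q\<^sup>2 + 3 * t'\<^sup>2)" unfolding e by simp
      moreover have "\<not> 3 dvd q\<^sup>2 + 3 * t'\<^sup>2"
        using q3 by (simp add: dvd_add_left_iff prime_dvd_power_iff)
      ultimately have "3 dvd t'" by (simp add: prime_dvd_mult_iff)
      then obtain t where t: "t' = 3 * t" by blast
      have tz: "t * (q\<^sup>2 + 3 * (3 * t)\<^sup>2) = z' ^ 3" using e unfolding t by simp
      have pt: "p = 9 * t" using t t' by simp
      have t0: "t \<noteq> 0" using p0 pt by simp
      have "coprime q (3 * (3 * t))" using cpq unfolding t t' by (subst coprime_commute)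
      then have cqt: "coprime q (3 * t)" unfolding coprime_mult_right_iff[of q 3 "3 * t"] ..
      have oqt: "odd (q + 3 * t)" using opq unfolding pt by simp
      have "coprime t (q\<^sup>2)" using cqt by (simp add: coprime_commute)
      then have "coprime t (27 * t * t + q\<^sup>2)" by (metis coprime_iff_gcd_eq_1 gcd_add_mult)
      moreover have "27 * t * t + q\<^sup>2 = q\<^sup>2 + 3 * (3 * t)\<^sup>2" by algebra
      ultimately have c: "coprime t (q\<^sup>2 + 3 * (3 * t)\<^sup>2)" by simp
      obtain r where r: "t = r ^ 3" using coprime_mult_eq_cube[OF c tz] by blast
      obtain s where s: "q\<^sup>2 + 3 * (3 * t)\<^sup>2 = s ^ 3"
        using coprime_mult_eq_cube[of "q\<^sup>2 + 3 * (3 * t)\<^sup>2" t z'] c tz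
        by (metis coprime_commute mult.commute)
      obtain u v where uv: "q = u * (u\<^sup>2 - 9 * v\<^sup>2)" "3 * t = 3 * v * (u\<^sup>2 - v\<^sup>2)"
        "coprime u v" "odd (u + v)"
        using norm_form_cube_parametrization[OF cqt oqt s] by blast
      have tv: "t = v * (u\<^sup>2 - v\<^sup>2)" using uv(2) by simp
      have "coprime v u" using uv(3) by (simp add: coprime_commute)
      from coprime_self_add_diff[OF this] have 1: "coprime v (u + v)" "coprime v (u - v)"
        by (simp_all add: add.commute)
      have "v * (u + v) * (u - v) = r ^ 3"
        using tv unfolding r by (simp add: power2_eq_square algebra_simps)
      with 1 coprime_add_diff[OF uv(3,4)]
      obtain c a b where abc: "v = c ^ 3" "u + v = a ^ 3" "u - v = b ^ 3"
        using coprime_mult3_eq_cube by metis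
      have "coprime (a ^ 3) (b ^ 3)" using coprime_add_diff[OF uv(3,4)] unfolding abc(2,3) .
      then have "coprime a (- b)" by simp
      \<comment> \<open>Here the difference of \<open>u + v\<close> and \<open>u - v\<close> is
        \<open>2 * v\<close>, so \<open>b\<close> enters with a minus sign.\<close>
      moreover have "a ^ 3 + (- b) ^ 3 = 2 * c ^ 3" using abc by simp
      moreover have "c \<noteq> 0" using abc(1) tv t0 by auto
      moreover have "c ^ 3 dvd p" using tv abc(1) pt by simp
      then have "\<bar>c\<bar> < \<bar>z\<bar>" using abs_less_of_cube_dvd[OF _ pz p0] norm by blast
      then have "nat \<bar>c\<bar> < nat \<bar>z\<bar>" by linarith
      ultimately have "a = - b" using IH by blast
      then have "u = 0" using abc by simp
      then show False using uv(1) q0 by simp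
    qed
  qed
  then show ?case using x y by simp
qed

section \<open>Products that are never cubes\<close>

text \<open>The factor \<open>x - y\<close> is a unit. The value 1 leads to
  \<open>y * (y + 1) = 0\<close>, the value -1 to a contradiction modulo 3.\<close>

lemma consecutive_cubes:
  fixes x y :: int
  assumes "x ^ 3 - y ^ 3 = 1"
  shows "x = 0 \<or> y = 0"
proof -
  have "(x - y) * (x\<^sup>2 + x * y + y\<^sup>2) = 1" using assms by algebra
  then have "x - y = 1 \<or> x - y = - 1" by (metis zmult_eq_1_iff)
  then show ?thesis
  proof
    assume "x - y = 1"
    then have "x = y + 1" by simp
    with assms have "3 * (y * (y + 1)) = 0" by algebra
    then show ?thesis using \<open>x = y + 1\<close> by auto
  next
    assume "x - y = - 1"
    then have "y = x + 1" by simp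
    with assms have "3 * (x * (x + 1)) = - 2" by (simp add: power3_eq_cube algebra_simps)
    then have "(3::int) dvd - 2" by (metis dvd_triv_left)
    then show ?thesis by simp
  qed
qed

lemma not_cube_square_mult_pred:
  fixes a :: int
  assumes "a \<noteq> 0" "a \<noteq> 1"
  shows "\<not> is_cube (a ^ 2 * (a - 1))" "\<not> is_cube (a ^ 2 * (a - 1) ^ 2)"
proof -
  have "coprime a (a - 1)" by (rule coprime_self_add_diff(2)) simp
  then have cop: "coprime (a ^ i) ((a - 1) ^ j)" for i j by simp
  have no: False if a: "a ^ 2 = r ^ 3" and b: "(a - 1) ^ i = t ^ 3" "i = 1 \<or> i = 2" for r t i
  proof -
    \<comment> \<open>From \<open>c ^ 3 = c * w ^ 3\<close> one gets \<open>c = w * m\<close>; then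
      \<open>w = m ^ 2\<close> and \<open>c = m ^ 3\<close>.\<close>
    have cube: "\<exists>w. c = w ^ 3" if "c ^ 2 = w ^ 3" for c w :: int
    proof (cases "c = 0")
      case False
      then have "c ^ 3 = c * w ^ 3" using that by (simp add: power3_eq_cube power2_eq_square)
      then have "w ^ 3 dvd c ^ 3" by simp
      then have "w dvd c" by simp
      then obtain m where m: "c = w * m" by blast
      with that False have "w = m ^ 2" by (auto simp: power2_eq_square power3_eq_cube)
      with m show ?thesis by (auto simp: power2_eq_square power3_eq_cube)
    qed (auto intro: exI[of _ 0])
    obtain x where x: "a = x ^ 3" using cube a by blast
    obtain y where y: "a - 1 = y ^ 3" using cube b by auto
    have "x ^ 3 - y ^ 3 = 1" using x y by simp
    then have "x = 0 \<or> y = 0" by (rule consecutive_cubes)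
    then show False using x y assms by auto
  qed
  have key: "\<not> is_cube (a ^ 2 * (a - 1) ^ i)" if i: "i = 1 \<or> i = 2" for i
  proof
    assume "is_cube (a ^ 2 * (a - 1) ^ i)"
    then obtain \<beta> where \<beta>: "a ^ 2 * (a - 1) ^ i = \<beta> ^ 3" by (auto simp: is_cube_def)
    obtain r where "a ^ 2 = r ^ 3" using coprime_mult_eq_cube[OF cop \<beta>] by blast
    moreover have "coprime ((a - 1) ^ i) (a ^ 2)" "(a - 1) ^ i * a ^ 2 = \<beta> ^ 3"
      using cop[of 2 i] \<beta> by (simp_all only: coprime_commute mult.commute)
    then obtain t where "(a - 1) ^ i = t ^ 3" by (rule coprime_mult_eq_cube)
    ultimately show False using i by (rule no)
  qed
  show "\<not> is_cube (a ^ 2 * (a - 1))" "\<not> is_cube (a ^ 2 * (a - 1) ^ 2)"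
    using key[of 1] key[of 2] by simp_all
qed

text \<open>The factors are coprime because \<open>2 * a - 1\<close> exceeds twice
  \<open>a - 1\<close> by 1. If both are cubes, Euler's theorem with \<open>y = - 1\<close> leaves
  only \<open>2 * a - 1 = - 1\<close>.\<close>

lemma not_cube_pred_mult_double_pred:
  fixes a :: int
  assumes "a \<noteq> 0" "a \<noteq> 1"
  shows "\<not> is_cube ((a - 1) * (2 * a - 1))"
proof
  assume "is_cube ((a - 1) * (2 * a - 1))"
  then obtain \<beta> where \<beta>: "(a - 1) * (2 * a - 1) = \<beta> ^ 3" by (auto simp: is_cube_def)
  have c: "coprime (a - 1) (2 * a - 1)"
  proof (rule coprimeI)
    fix l assume "l dvd a - 1" "l dvd 2 * a - 1"
    then have "l dvd (2 * a - 1) - 2 * (a - 1)" using dvd_diff dvd_mult by blast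
    then show "is_unit l" by simp
  qed
  obtain u where u: "a - 1 = u ^ 3" using coprime_mult_eq_cube[OF c \<beta>] by blast
  obtain v where v: "2 * a - 1 = v ^ 3"
    using coprime_mult_eq_cube[of "2 * a - 1" "a - 1" \<beta>] c \<beta> by (metis coprime_commute mult.commute)
  have "u \<noteq> 0" using u assms by auto
  moreover have "v ^ 3 + (- 1) ^ 3 = 2 * u ^ 3" using u v by simp
  ultimately have "v = - 1" using sum_of_two_cubes_eq_twice_cube[of v "- 1" u] by simp
  then show False using v assms by simp
qed


section \<open>Elliptic divisibility sequences of rank 8\<close>

text \<open>The second half of the list mirrors the first: the entry at 8 - r is
  \<open>w ^ (4 - r)\<close> times the entry at r, for r from 1 to 4.\<close>

definition rank8_seq :: "int \<Rightarrow> int \<Rightarrow> int \<Rightarrow> int \<Rightarrow> nat \<Rightarrow> int" where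
  "rank8_seq w x y z n = (- 1) ^ (n div 8) * w ^ (4 * (n div 8)\<^sup>2 + (n div 8) * (n mod 8)) *
     [0, 1, x, y, z, w * y, w\<^sup>2 * x, w ^ 3] ! (n mod 8)"

lemma rank8_seq_shift:
  "rank8_seq w x y z (8 * j + i) = (- 1) ^ j * w ^ (4 * j\<^sup>2 + j * i) * rank8_seq w x y z i"
proof -
  define k r where "k = i div 8" and "r = i mod 8"
  have i: "i = 8 * k + r" by (simp add: k_def r_def)
  have "4 * (j + k)\<^sup>2 + (j + k) * r = (4 * j\<^sup>2 + j * i) + (4 * k\<^sup>2 + k * r)"
    unfolding i by (simp add: power2_eq_square algebra_simps)
  moreover have "(8 * j + i) div 8 = j + k" "(8 * j + i) mod 8 = r"
    by (simp_all add: k_def r_def)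
  ultimately show ?thesis
    unfolding rank8_seq_def by (simp only: power_add flip: k_def r_def) (simp only: mult_ac)
qed

text \<open>The assumptions are the recurrences for the terms 5, 6 (multiplied by \<open>x\<close>)
  and 7. With the quasi-period 8 they imply all other instances.\<close>

context
  fixes w x y z :: int
  assumes rel5: "w * y = z * x ^ 3 - y ^ 3"
    and rel6: "w\<^sup>2 * x\<^sup>2 = y * (w * y * x\<^sup>2 - z\<^sup>2)"
    and rel7: "w ^ 3 = w * y ^ 4 - x * z ^ 3"
begin

private abbreviation "H \<equiv> rank8_seq w x y z"

text \<open>Representatives 2 to 9 instead of 0 to 7 keep \<open>i - 1\<close> and
  \<open>i - 2\<close> free of truncation.\<close>

private lemma residue_cases:
  fixes m :: nat
  assumes "m \<ge> 2"
  obtains j i where "m = 8 * j + i" "i \<in> {2, 3, 4, 5, 6, 7, 8, 9}"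
proof (rule that)
  show "m = 8 * ((m - 2) div 8) + ((m - 2) mod 8 + 2)" using assms by simp
  have "t + 2 \<in> {2, 3, 4, 5, 6, 7, 8, 9}" if "t < 8" for t :: nat using that by simp presburger
  then show "(m - 2) mod 8 + 2 \<in> {2, 3, 4, 5, 6, 7, 8, 9}" by simp
qed

private lemma rank8_seq_values:
  "H 0 = 0" "H 1 = 1" "H 2 = x" "H 3 = y" "H 4 = z" "H 5 = w * y" "H 6 = w\<^sup>2 * x" "H 7 = w ^ 3"
  "H 8 = 0" "H 9 = - (w ^ 5)" "H 10 = - (w ^ 6 * x)" "H 11 = - (w ^ 7 * y)" "H 12 = - (w ^ 8 * z)"
  "H 13 = - (w ^ 10 * y)" "H 14 = - (w ^ 12 * x)" "H 15 = - (w ^ 14)" "H 16 = 0"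
  "H 17 = w ^ 18" "H 18 = w ^ 20 * x" "H 19 = w ^ 22 * y"
  by (simp_all add: rank8_seq_def) (simp_all add: eval_nat_numeral mult_ac)

text \<open>Shifting the index by \<open>8 * j\<close> rescales the terms geometrically in
  \<open>r\<close>. The recurrences are homogeneous for such scalings, so they need checking only
  for \<open>i\<close> from 2 to 9.\<close>

private lemma rank8_seq_rescale:
  fixes j d :: nat
  obtains A B s :: int where "s ^ 4 = 1"
    "\<And>r. H (8 * j + (d + r)) = s * A * B ^ r * H (d + r)"
    "\<And>r. H (8 * (2 * j) + (2 * d + r)) = A ^ 4 * B ^ (2 * r) * H (2 * d + r)"
proof (rule that[of "(- 1) ^ j" "w ^ (4 * j\<^sup>2 + j * d)" "w ^ j"])
  show "((- 1) ^ j) ^ 4 = (1::int)" by (cases "even j") auto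
  fix r
  have "4 * j\<^sup>2 + j * (d + r) = (4 * j\<^sup>2 + j * d) + j * r" by (simp add: algebra_simps)
  then show "H (8 * j + (d + r)) = (- 1) ^ j * w ^ (4 * j\<^sup>2 + j * d) * (w ^ j) ^ r * H (d + r)"
    unfolding rank8_seq_shift by (simp only: power_add power_mult mult_ac)
  have "4 * (2 * j)\<^sup>2 + 2 * j * (2 * d + r) = (4 * j\<^sup>2 + j * d) * 4 + j * (2 * r)"
    by (simp add: algebra_simps power2_eq_square)
  then show "H (8 * (2 * j) + (2 * d + r)) =
      (w ^ (4 * j\<^sup>2 + j * d)) ^ 4 * (w ^ j) ^ (2 * r) * H (2 * d + r)"
    unfolding rank8_seq_shift by (simp only: power_add power_mult) simp
qed

lemma rank8_seq_odd:
  assumes "m \<ge> 2"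
  shows "H (2 * m + 1) = H (m + 2) * H m ^ 3 - H (m - 1) * H (m + 1) ^ 3"
proof -
  obtain j i where m: "m = 8 * j + i" and i: "i \<in> {2, 3, 4, 5, 6, 7, 8, 9}"
    using residue_cases[OF assms] .
  have eqs: "H 5 = H 4 * H 2 ^ 3 - H 1 * H 3 ^ 3" "H 7 = H 5 * H 3 ^ 3 - H 2 * H 4 ^ 3"
    "H 9 = H 6 * H 4 ^ 3 - H 3 * H 5 ^ 3" "H 11 = H 7 * H 5 ^ 3 - H 4 * H 6 ^ 3"
    unfolding rank8_seq_values using rel5 rel7 by algebra+
  \<comment> \<open>In these instances \<open>H 8 = 0\<close> kills one product, and the rest is an
    identity of monomials.\<close>
  have eqs0: "H 13 = H 8 * H 6 ^ 3 - H 5 * H 7 ^ 3" "H 15 = H 9 * H 7 ^ 3 - H 6 * H 8 ^ 3"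
    "H 17 = H 10 * H 8 ^ 3 - H 7 * H 9 ^ 3" "H 19 = H 11 * H 9 ^ 3 - H 8 * H 10 ^ 3"
    unfolding rank8_seq_values by (simp_all add: eval_nat_numeral mult_ac)
  define P where "P i \<longleftrightarrow> H (2 * i + 1) = H (i + 2) * H i ^ 3 - H (i - 1) * H (i + 1) ^ 3" for i
  have "P 2" using eqs(1) by (simp add: P_def)
  moreover have "P 3" using eqs(2) by (simp add: P_def)
  moreover have "P 4" using eqs(3) by (simp add: P_def)
  moreover have "P 5" using eqs(4) by (simp add: P_def)
  moreover have "P 6" using eqs0(1) by (simp add: P_def)
  moreover have "P 7" using eqs0(2) by (simp add: P_def)
  moreover have "P 8" using eqs0(3) by (simp add: P_def)
  moreover have "P 9" using eqs0(4) by (simp add: P_def)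
  ultimately have "P i" using i by blast
  note base = this[unfolded P_def]
  define d where "d = i - 2"
  have d: "i = d + 2" using i by (auto simp: d_def)
  obtain A B s where s: "s ^ 4 = 1"
    and sh: "\<And>r. H (8 * j + (d + r)) = s * A * B ^ r * H (d + r)"
    and sh2: "\<And>r. H (8 * (2 * j) + (2 * d + r)) = A ^ 4 * B ^ (2 * r) * H (2 * d + r)"
    by (rule rank8_seq_rescale[of j d]) (rule that)
  have ix: "2 * m + 1 = 8 * (2 * j) + (2 * d + 5)" "m + 2 = 8 * j + (d + 4)" "m = 8 * j + (d + 2)"
    "m - 1 = 8 * j + (d + 1)" "m + 1 = 8 * j + (d + 3)"
    "2 * i + 1 = 2 * d + 5" "i + 2 = d + 4" "i - 1 = d + 1" "i + 1 = d + 3"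
    using m d by simp_all
  \<comment> \<open>The exponent of \<open>B\<close> is 4 + 3 * 2 = 1 + 3 * 3 = 10 in both products,
    and 2 * 5 on the left of the recurrence.\<close>
  have "H (m + 2) * H m ^ 3 - H (m - 1) * H (m + 1) ^ 3 =
      s ^ 4 * (A ^ 4 * B ^ 10 * (H (i + 2) * H i ^ 3 - H (i - 1) * H (i + 1) ^ 3))"
    unfolding sh[of 4, folded ix d] sh[of 2, folded ix d] sh[of 1, folded ix d] sh[of 3, folded ix d]
    by algebra
  also have "\<dots> = H (2 * m + 1)"
    unfolding base[symmetric] s using sh2[of 5, folded ix] by simp
  finally show ?thesis ..
qed

lemma rank8_seq_even:
  assumes "m \<ge> 2"
  shows "H (2 * m) * H 2 = H m * (H (m + 2) * H (m - 1) ^ 2 - H (m - 2) * H (m + 1) ^ 2)"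
proof -
  obtain j i where m: "m = 8 * j + i" and i: "i \<in> {2, 3, 4, 5, 6, 7, 8, 9}"
    using residue_cases[OF assms] .
  have eqs: "H 6 * H 2 = H 3 * (H 5 * H 2 ^ 2 - H 1 * H 4 ^ 2)"
    "H 10 * H 2 = H 5 * (H 7 * H 4 ^ 2 - H 3 * H 6 ^ 2)"
    unfolding rank8_seq_values using rel6 by algebra+
  have eqs0: "H 4 * H 2 = H 2 * (H 4 * H 1 ^ 2 - H 0 * H 3 ^ 2)"
    "H 8 * H 2 = H 4 * (H 6 * H 3 ^ 2 - H 2 * H 5 ^ 2)"
    "H 12 * H 2 = H 6 * (H 8 * H 5 ^ 2 - H 4 * H 7 ^ 2)"
    "H 14 * H 2 = H 7 * (H 9 * H 6 ^ 2 - H 5 * H 8 ^ 2)"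
    "H 16 * H 2 = H 8 * (H 10 * H 7 ^ 2 - H 6 * H 9 ^ 2)"
    "H 18 * H 2 = H 9 * (H 11 * H 8 ^ 2 - H 7 * H 10 ^ 2)"
    unfolding rank8_seq_values by (simp_all add: eval_nat_numeral mult_ac)
  define P where "P i \<longleftrightarrow>
    H (2 * i) * H 2 = H i * (H (i + 2) * H (i - 1) ^ 2 - H (i - 2) * H (i + 1) ^ 2)" for i
  have "P 2" using eqs0(1) by (simp add: P_def)
  moreover have "P 3" using eqs(1) by (simp add: P_def)
  moreover have "P 4" using eqs0(2) by (simp add: P_def)
  moreover have "P 5" using eqs(2) by (simp add: P_def)
  moreover have "P 6" using eqs0(3) by (simp add: P_def)
  moreover have "P 7" using eqs0(4) by (simp add: P_def)
  moreover have "P 8" using eqs0(5) by (simp add: P_def)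
  moreover have "P 9" using eqs0(6) by (simp add: P_def)
  ultimately have "P i" using i by blast
  note base = this[unfolded P_def]
  define d where "d = i - 2"
  have d: "i = d + 2" using i by (auto simp: d_def)
  obtain A B s where s: "s ^ 4 = 1"
    and sh: "\<And>r. H (8 * j + (d + r)) = s * A * B ^ r * H (d + r)"
    and sh2: "\<And>r. H (8 * (2 * j) + (2 * d + r)) = A ^ 4 * B ^ (2 * r) * H (2 * d + r)"
    by (rule rank8_seq_rescale[of j d]) (rule that)
  have ix: "2 * m = 8 * (2 * j) + (2 * d + 4)" "m + 2 = 8 * j + (d + 4)" "m = 8 * j + (d + 2)"
    "m - 1 = 8 * j + (d + 1)" "m - 2 = 8 * j + (d + 0)" "m + 1 = 8 * j + (d + 3)"
    "2 * i = 2 * d + 4" "i + 2 = d + 4" "i - 1 = d + 1" "i - 2 = d + 0" "i + 1 = d + 3"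
    using m d by simp_all
  \<comment> \<open>Here the exponent of \<open>B\<close> is 2 + 4 + 2 * 1 = 2 + 0 + 2 * 3 = 8,
    matching 2 * 4 for \<open>H (2 * m)\<close>.\<close>
  have "H m * (H (m + 2) * H (m - 1) ^ 2 - H (m - 2) * H (m + 1) ^ 2) =
      s ^ 4 * (A ^ 4 * B ^ 8 * (H i * (H (i + 2) * H (i - 1) ^ 2 - H (i - 2) * H (i + 1) ^ 2)))"
    unfolding sh[of 4, folded ix d] sh[of 2, folded ix d] sh[of 1, folded ix d] sh[of 3, folded ix d]
      sh[of 0, folded ix d] power_0 mult_1_right
    by algebra
  also have "\<dots> = H (2 * m) * H 2"
    unfolding base[symmetric] s using sh2[of 4, folded ix] by simp
  finally show ?thesis ..
qed

text \<open>From index 5 on, each recurrence refers only to smaller indices, and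
  \<open>x \<noteq> 0\<close> allows cancelling the division by \<open>h 2\<close>.\<close>

lemma rank8_seq_unique:
  fixes h :: "nat \<Rightarrow> rat"
  assumes "x \<noteq> 0" and init: "h 0 = 0" "h 1 = 1" "h 2 = of_int x" "h 3 = of_int y" "h 4 = of_int z"
    and odd: "\<And>m. m \<ge> 2 \<Longrightarrow> h (2 * m + 1) = h (m + 2) * h m ^ 3 - h (m - 1) * h (m + 1) ^ 3"
    and even: "\<And>m. m \<ge> 3 \<Longrightarrow>
      h (2 * m) = h m * (h (m + 2) * h (m - 1) ^ 2 - h (m - 2) * h (m + 1) ^ 2) / h 2"
  shows "h n = of_int (H n)"
proof (induction n rule: less_induct)
  case (less n)
  have "n < 5 \<or> (\<exists>m\<ge>2. n = 2 * m + 1) \<or> (\<exists>m\<ge>3. n = 2 * m)" by presburger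
  then consider "n < 5" | m where "m \<ge> 2" "n = 2 * m + 1" | m where "m \<ge> 3" "n = 2 * m" by blast
  then show ?case
  proof cases
    case 1
    then have "n \<in> {0, 1, 2, 3, 4}" by auto
    then show ?thesis using init rank8_seq_values by auto
  next
    case 2
    then have "m + 2 < n" "m < n" "m - 1 < n" "m + 1 < n" by auto
    then have "h n = of_int (H (m + 2)) * of_int (H m) ^ 3 - of_int (H (m - 1)) * of_int (H (m + 1)) ^ 3"
      using less.IH odd[OF 2(1)] 2(2) by metis
    then show ?thesis using rank8_seq_odd[OF 2(1)] 2(2) by simp
  next
    case 3
    then have "m + 2 < n" "m < n" "m - 1 < n" "m - 2 < n" "m + 1 < n" "2 < n" by auto
    then have "h n = of_int (H m) * (of_int (H (m + 2)) * of_int (H (m - 1)) ^ 2 -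
        of_int (H (m - 2)) * of_int (H (m + 1)) ^ 2) / of_int (H 2)"
      using less.IH even[OF 3(1)] 3(2) by metis
    also have "\<dots> = of_int (H (2 * m) * H 2) / of_int (H 2)"
      using rank8_seq_even[of m] 3(1) by simp
    also have "\<dots> = of_int (H n)" using assms(1) rank8_seq_values 3(2) by simp
    finally show ?thesis .
  qed
qed

end

section \<open>The terms modulo cubes\<close>

lemma is_cube_cube_mult_iff:
  assumes "y \<noteq> 0"
  shows "is_cube (y ^ 3 * t) \<longleftrightarrow> is_cube t"
proof
  assume "is_cube (y ^ 3 * t)"
  then obtain \<beta> where \<beta>: "\<beta> \<noteq> 0" "y ^ 3 * t = \<beta> ^ 3" by (auto simp: is_cube_def)
  then have "y ^ 3 dvd \<beta> ^ 3" by (metis dvd_triv_left)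
  then obtain \<gamma> where "\<beta> = y * \<gamma>" by (auto elim: dvdE)
  with \<beta> assms show "is_cube t" by (auto simp: is_cube_def power_mult_distrib)
next
  assume "is_cube t"
  then obtain \<beta> where "\<beta> \<noteq> 0" "t = \<beta> ^ 3" by (auto simp: is_cube_def)
  then have "y * \<beta> \<noteq> 0" "y ^ 3 * t = (y * \<beta>) ^ 3" using assms by (simp_all add: power_mult_distrib)
  then show "is_cube (y ^ 3 * t)" unfolding is_cube_def by blast
qed

theorem theorem5p14:
  fixes \<alpha> :: int and h :: "nat \<Rightarrow> rat" and n :: nat
  assumes "\<alpha> \<noteq> 0" and "\<alpha> \<noteq> 1"
    and "h 0 = 0" and "h 1 = 1"
    and "h 2 = of_int (- (\<alpha> ^ 3 * (\<alpha> - 1) * (2 * \<alpha> - 1)))"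
    and "h 3 = of_int (- (\<alpha> ^ 8 * (\<alpha> - 1) ^ 3 * (2 * \<alpha> - 1) ^ 3))"
    and "h 4 = of_int (\<alpha> ^ 14 * (\<alpha> - 1) ^ 6 * (2 * \<alpha> - 1) ^ 6)"
    and "\<And>m. m \<ge> 2 \<Longrightarrow>
           h (2 * m + 1) = h (m + 2) * h m ^ 3 - h (m - 1) * h (m + 1) ^ 3"
    and "\<And>m. m \<ge> 3 \<Longrightarrow>
           h (2 * m) = h m * (h (m + 2) * h (m - 1) ^ 2 - h (m - 2) * h (m + 1) ^ 2) / h 2"
    and "n mod 24 \<in> {2, 5, 10, 11, 12, 13, 14, 19, 22}"
  shows "\<not> (\<exists>k::int. h n = of_int k \<and> is_cube k)"
proof -
  define b c where "b = \<alpha> - 1" and "c = 2 * \<alpha> - 1"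
  have "c \<noteq> 0" unfolding c_def by presburger
  then have nz: "\<alpha> \<noteq> 0" "b \<noteq> 0" "c \<noteq> 0" using assms(1,2) by (auto simp: b_def)
  define w x y z where "w = - (\<alpha> ^ 15 * b ^ 7 * c ^ 6)" and "x = - (\<alpha> ^ 3 * b * c)"
    and "y = - (\<alpha> ^ 8 * b ^ 3 * c ^ 3)" and "z = \<alpha> ^ 14 * b ^ 6 * c ^ 6"
  note defs = w_def x_def y_def z_def
  \<comment> \<open>The three relations come down to \<open>\<alpha> - 1 = b\<close>,
    \<open>c - \<alpha> = b\<close> and \<open>\<alpha>\<^sup>2 - c = b\<^sup>2\<close>.\<close>
  have "z * x ^ 3 - y ^ 3 = \<alpha> ^ 23 * b ^ 9 * c ^ 9 * (\<alpha> - 1)" unfolding defs by algebra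
  also have "\<dots> = w * y" unfolding b_def[symmetric] defs by algebra
  finally have 1: "w * y = z * x ^ 3 - y ^ 3" ..
  have "y * (w * y * x\<^sup>2 - z\<^sup>2) = \<alpha> ^ 36 * b ^ 15 * c ^ 14 * (c - \<alpha>)" unfolding defs by algebra
  also have "c - \<alpha> = b" by (simp add: b_def c_def)
  also have "\<alpha> ^ 36 * b ^ 15 * c ^ 14 * b = w\<^sup>2 * x\<^sup>2" unfolding defs by algebra
  finally have 2: "w\<^sup>2 * x\<^sup>2 = y * (w * y * x\<^sup>2 - z\<^sup>2)" ..
  have "w * y ^ 4 - x * z ^ 3 = - (\<alpha> ^ 45 * b ^ 19 * c ^ 18 * (\<alpha>\<^sup>2 - c))" unfolding defs by algebra
  also have "\<alpha>\<^sup>2 - c = b\<^sup>2" unfolding b_def c_def by algebra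
  also have "- (\<alpha> ^ 45 * b ^ 19 * c ^ 18 * b\<^sup>2) = w ^ 3" unfolding defs by algebra
  finally have 3: "w ^ 3 = w * y ^ 4 - x * z ^ 3" ..
  have "x \<noteq> 0" using nz by (simp add: x_def)
  have h: "h n = of_int (rank8_seq w x y z n)"
    by (rule rank8_seq_unique[OF 1 2 3 \<open>x \<noteq> 0\<close> assms(3,4) _ _ _ assms(8,9)])
       (simp_all only: assms(5-7) defs b_def c_def)
  \<comment> \<open>Up to cubes \<open>w\<close> is \<open>b\<close>, and its exponent
    \<open>e\<close> modulo 3 depends only on \<open>k\<close> and \<open>r\<close>; hence the
    modulus 24. \<open>Y\<close> gathers the cube part and \<open>f\<close> is what remains.\<close>
  define q \<rho> where "q = n div 24" and "\<rho> = n mod 24"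
  define k r where "k = \<rho> div 8" and "r = \<rho> mod 8"
  define e where "e = 4 * (3 * q + k)\<^sup>2 + (3 * q + k) * r"
  define Y where "Y = (- 1) ^ (3 * q + k) * (- (\<alpha> ^ 5 * b\<^sup>2 * c\<^sup>2)) ^ e * b ^ (12 * q\<^sup>2 + 8 * q * k + q * r)"
  define f where "f = b ^ (4 * k\<^sup>2 + k * r) * [0, 1, x, y, z, w * y, w\<^sup>2 * x, w ^ 3] ! r"
  have "Y \<noteq> 0" using nz by (simp add: Y_def)
  have "n = 24 * q + \<rho>" "\<rho> = 8 * k + r" by (simp_all add: q_def \<rho>_def k_def r_def)
  then have "n = 8 * (3 * q + k) + r" by simp
  moreover have "(8 * t + r) div 8 = t" "(8 * t + r) mod 8 = r" for t by (simp_all add: r_def)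
  ultimately have n: "n div 8 = 3 * q + k" "n mod 8 = r" by metis+
  have "w = (- (\<alpha> ^ 5 * b\<^sup>2 * c\<^sup>2)) ^ 3 * b" unfolding w_def by algebra
  then have "w ^ e = ((- (\<alpha> ^ 5 * b\<^sup>2 * c\<^sup>2)) ^ e) ^ 3 * b ^ e"
    by (simp only: power_mult_distrib power_mult[symmetric] mult.commute)
  also have "e = (12 * q\<^sup>2 + 8 * q * k + q * r) * 3 + (4 * k\<^sup>2 + k * r)"
    by (simp add: e_def power2_eq_square algebra_simps)
  then have "b ^ e = (b ^ (12 * q\<^sup>2 + 8 * q * k + q * r)) ^ 3 * b ^ (4 * k\<^sup>2 + k * r)"
    by (simp only: power_add power_mult)
  finally have "rank8_seq w x y z n = Y ^ 3 * f"
    unfolding rank8_seq_def n e_def[symmetric] Y_def f_def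
    by (cases "even (3 * q + k)") (simp_all add: power_mult_distrib)
  then have reduce: "is_cube (rank8_seq w x y z n) \<longleftrightarrow> is_cube f"
    using is_cube_cube_mult_iff[OF \<open>Y \<noteq> 0\<close>] by simp
  \<comment> \<open>Reducing the exponents of the monomial \<open>f\<close> modulo 3 leaves
    \<open>b * c\<close> for 2, 10, 14, 22, then \<open>\<alpha>\<^sup>2 * b\<close> for 5, 11, 13,
    19 and \<open>\<alpha>\<^sup>2 * b\<^sup>2\<close> for 12; the witness \<open>u\<close> is the
    cube root of the rest.\<close>
  have "\<exists>u. u \<noteq> 0 \<and> (f = u ^ 3 * (b * c) \<or> f = u ^ 3 * (\<alpha>\<^sup>2 * b) \<or> f = u ^ 3 * (\<alpha>\<^sup>2 * b\<^sup>2))"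
  proof -
    have "\<rho> \<in> {2, 5, 10, 11, 12, 13, 14, 19, 22}" using assms(10) by (simp add: \<rho>_def)
    then consider "\<rho> = 2" | "\<rho> = 5" | "\<rho> = 10" | "\<rho> = 11" | "\<rho> = 12" | "\<rho> = 13" | "\<rho> = 14"
      | "\<rho> = 19" | "\<rho> = 22" by auto
    then show ?thesis
    proof cases
      case 1
      then have "f = x" by (simp add: f_def k_def r_def)
      also have "\<dots> = (- \<alpha>) ^ 3 * (b * c)" unfolding defs by algebra
      finally show ?thesis using nz by (intro exI[of _ "- \<alpha>"]) simp
    next
      case 2
      then have "f = w * y" by (simp add: f_def k_def r_def)
      also have "\<dots> = (\<alpha> ^ 7 * b ^ 3 * c ^ 3) ^ 3 * (\<alpha>\<^sup>2 * b)" unfolding defs by algebra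
      finally show ?thesis using nz by (intro exI[of _ "\<alpha> ^ 7 * b ^ 3 * c ^ 3"]) simp
    next
      case 3
      then have "f = b ^ 6 * x" by (simp add: f_def k_def r_def)
      also have "\<dots> = (- (\<alpha> * b\<^sup>2)) ^ 3 * (b * c)" unfolding defs by algebra
      finally show ?thesis using nz by (intro exI[of _ "- (\<alpha> * b\<^sup>2)"]) simp
    next
      case 4
      then have "f = b ^ 7 * y" by (simp add: f_def k_def r_def)
      also have "\<dots> = (- (\<alpha>\<^sup>2 * b ^ 3 * c)) ^ 3 * (\<alpha>\<^sup>2 * b)" unfolding defs by algebra
      finally show ?thesis using nz by (intro exI[of _ "- (\<alpha>\<^sup>2 * b ^ 3 * c)"]) simp
    next
      case 5
      then have "f = b ^ 8 * z" by (simp add: f_def k_def r_def)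
      also have "\<dots> = (\<alpha> ^ 4 * b ^ 4 * c\<^sup>2) ^ 3 * (\<alpha>\<^sup>2 * b\<^sup>2)" unfolding defs by algebra
      finally show ?thesis using nz by (intro exI[of _ "\<alpha> ^ 4 * b ^ 4 * c\<^sup>2"]) simp
    next
      case 6
      then have "f = b ^ 9 * (w * y)" by (simp add: f_def k_def r_def)
      also have "\<dots> = (\<alpha> ^ 7 * b ^ 6 * c ^ 3) ^ 3 * (\<alpha>\<^sup>2 * b)" unfolding defs by algebra
      finally show ?thesis using nz by (intro exI[of _ "\<alpha> ^ 7 * b ^ 6 * c ^ 3"]) simp
    next
      case 7
      then have "f = b ^ 10 * (w\<^sup>2 * x)" by (simp add: f_def k_def r_def)
      also have "\<dots> = (- (\<alpha> ^ 11 * b ^ 8 * c ^ 4)) ^ 3 * (b * c)" unfolding defs by algebra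
      finally show ?thesis using nz by (intro exI[of _ "- (\<alpha> ^ 11 * b ^ 8 * c ^ 4)"]) simp
    next
      case 8
      then have "f = b ^ 22 * y" by (simp add: f_def k_def r_def)
      also have "\<dots> = (- (\<alpha>\<^sup>2 * b ^ 8 * c)) ^ 3 * (\<alpha>\<^sup>2 * b)" unfolding defs by algebra
      finally show ?thesis using nz by (intro exI[of _ "- (\<alpha>\<^sup>2 * b ^ 8 * c)"]) simp
    next
      case 9
      then have "f = b ^ 28 * (w\<^sup>2 * x)" by (simp add: f_def k_def r_def)
      also have "\<dots> = (- (\<alpha> ^ 11 * b ^ 14 * c ^ 4)) ^ 3 * (b * c)" unfolding defs by algebra
      finally show ?thesis using nz by (intro exI[of _ "- (\<alpha> ^ 11 * b ^ 14 * c ^ 4)"]) simp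
    qed
  qed
  then have "\<not> is_cube f"
    using not_cube_square_mult_pred[OF assms(1,2)] not_cube_pred_mult_double_pred[OF assms(1,2)]
    by (auto simp: is_cube_cube_mult_iff simp flip: b_def c_def)
  then show ?thesis using reduce h by simp
qed

end
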